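(* Let $D\subseteq\mathbb{R}$, let $f:D\to\mathbb{R}$ be a real-valued function, let $C=[(\underline{c}_L,\overline{c}_L),(\underline{c}_U,\overline{c}_U)]\in I_2(\mathbb{R})$, and let $F_2:D\to I_2(\mathbb{R})$ be given by $F_2(x)=C f(x)$. Let $x_o$ be a limit point of $D$. If $\lim_{x\to x_o}F_2(x)$ exists, then one of the following cases holds: (a) $\lim_{x\to x_o}f(x)$ exists and $\lim_{x\to x_o}F_2(x)=C\cdot\lim_{x\to x_o}f(x)$; (b) $\lim_{x\to x_o}|f(x)|$ exists and $[\underline{c}_L,\overline{c}_L]=-[\underline{c}_U,\overline{c}_U]$.
   Context: A Type-2 interval is given by four real numbers $\underline{a}_L\le\overline{a}_L\le\underline{a}_U\le\overline{a}_U$ and is written $A=[(\underline{a}_L,\overline{a}_L),(\underline{a}_U,\overline{a}_U)]$; $I_2(\mathbb{R})$ denotes the set of all Type-2 intervals, with equality meaning equality of the four corresponding entries. For $\lambda\in\mathbb{R}$, the scalar multiple $\lambda A=A\lambda$ is $[(\lambda\underline{a}_L,\lambda\overline{a}_L),(\lambda\underline{a}_U,\lambda\overline{a}_U)]$ if $\lambda\ge0$ and $[(\lambda\overline{a}_U,\lambda\underline{a}_U),(\lambda\overline{a}_L,\lambda\underline{a}_L)]$ if $\lambda<0$. For an ordinary interval, $-[p,q]=[-q,-p]$. The extended Moore distance is $$D_{M_2}(X,Y)=\max\{|\underline{x}_L-\underline{y}_L|,\ |\overline{x}_L-\overline{y}_L|,\ |\underline{x}_U-\underline{y}_U|,\ |\overline{x}_U-\overline{y}_U|\}.$$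 For $F_2:D\to I_2(\mathbb{R})$, a limit point $x_o$ of $D$ and $L\in I_2(\mathbb{R})$, $\lim_{x\to x_o}F_2(x)=L$ means: for every $\varepsilon>0$ there is $\delta>0$ such that $D_{M_2}(F_2(x),L)<\varepsilon$ for all $x\in D$ with $0<|x-x_o|<\delta$. Limits of real functions are finite limits.
   Formalization: The hypothesis C ≠ [(0,0),(0,0)] is added; for C = [(0,0),(0,0)] the claim is false: with D = ℝ, x_o = 0 and f the indicator of (0,∞), F_2 is constantly zero and has a limit, but neither lim f nor lim |f| exists. *)

theory Defs
  imports "HOL-Analysis.Analysis" "HOL-Library.Interval"
begin

typedef type2_interval =
  "{(a :: real, b :: real, c :: real, d :: real). a \<le> b \<and> b \<le> c \<and> c \<le> d}"
  morphisms entries Type2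
  by (rule exI[of _ "(0, 0, 0, 0)"]) simp

setup_lifting type_definition_type2_interval

text \<open>
  The four entries of \<open>A = [(lowL A, uppL A), (lowU A, uppU A)]\<close>: the prefix
  low/upp stands for the under-/overlined letter, the suffix for the subscript.
\<close>

lift_definition lowL :: "type2_interval \<Rightarrow> real" is "\<lambda>(a, b, c, d). a" .
lift_definition uppL :: "type2_interval \<Rightarrow> real" is "\<lambda>(a, b, c, d). b" .
lift_definition lowU :: "type2_interval \<Rightarrow> real" is "\<lambda>(a, b, c, d). c" .
lift_definition uppU :: "type2_interval \<Rightarrow> real" is "\<lambda>(a, b, c, d). d" .

lemma type2_eq_iff:
  "A = B \<longleftrightarrow> lowL A = lowL B \<and> uppL A = uppL B \<and> lowU A = lowU B \<and> uppU A = uppU B"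
  by transfer auto

lemma entries_le [simp]: "lowL A \<le> uppL A" "uppL A \<le> lowU A" "lowU A \<le> uppU A"
  by (transfer; auto)+

definition intervalL :: "type2_interval \<Rightarrow> real interval" where
  "intervalL A = Interval (lowL A, uppL A)"

definition intervalU :: "type2_interval \<Rightarrow> real interval" where
  "intervalU A = Interval (lowU A, uppU A)"

lemma bounds_intervalL [simp]: "lower (intervalL A) = lowL A" "upper (intervalL A) = uppL A"
  by (simp_all add: intervalL_def lower.rep_eq upper.rep_eq Interval_inverse)

lemma bounds_intervalU [simp]: "lower (intervalU A) = lowU A" "upper (intervalU A) = uppU A"
  by (simp_all add: intervalU_def lower.rep_eq upper.rep_eq Interval_inverse)

instantiation type2_interval :: zero
begin

lift_definition zero_type2_interval :: type2_interval is "(0, 0, 0, 0)" by simp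

instance ..

end

text \<open>
  Only the syntactic class \<^class>\<open>scaleR\<close> is instantiated: Type-2 intervals do not form a
  vector space.
\<close>

instantiation type2_interval :: scaleR
begin

lift_definition scaleR_type2_interval :: "real \<Rightarrow> type2_interval \<Rightarrow> type2_interval" is
  "\<lambda>r (a, b, c, d). if 0 \<le> r then (r * a, r * b, r * c, r * d) else (r * d, r * c, r * b, r * a)"
  by (auto simp: mult_left_mono mult_left_mono_neg split: if_splits)

instance ..

end

lemma entries_scaleR:
  "lowL (r *\<^sub>R A) = (if 0 \<le> r then r * lowL A else r * uppU A)"
  "uppL (r *\<^sub>R A) = (if 0 \<le> r then r * uppL A else r * lowU A)"
  "lowU (r *\<^sub>R A) = (if 0 \<le> r then r * lowU A else r * uppL A)"
  "uppU (r *\<^sub>R A) = (if 0 \<le> r then r * uppU A else r * lowL A)"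
  by (transfer; auto)+

lemma entries_zero [simp]:
  "lowL 0 = 0" "uppL 0 = 0" "lowU 0 = 0" "uppU 0 = 0"
  by (transfer; auto)+

text \<open>
  The metric is the extended Moore distance, so that \<open>(F \<longlongrightarrow> L) (at x within D)\<close> is the
  limit taken with respect to that distance.
\<close>

instantiation type2_interval :: metric_space
begin

definition dist_type2_interval :: "type2_interval \<Rightarrow> type2_interval \<Rightarrow> real" where
  "dist_type2_interval X Y =
    Max {\<bar>lowL X - lowL Y\<bar>, \<bar>uppL X - uppL Y\<bar>, \<bar>lowU X - lowU Y\<bar>, \<bar>uppU X - uppU Y\<bar>}"

definition uniformity_type2_interval :: "(type2_interval \<times> type2_interval) filter" where
  "uniformity_type2_interval = (INF e\<in>{0 <..}. principal {(x, y). dist x y < e})"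

definition open_type2_interval :: "type2_interval set \<Rightarrow> bool" where
  "open_type2_interval S \<longleftrightarrow> (\<forall>x\<in>S. \<forall>\<^sub>F (x', y) in uniformity. x' = x \<longrightarrow> y \<in> S)"

instance
proof
  fix x y z :: type2_interval
  show "dist x y = 0 \<longleftrightarrow> x = y"
    by (auto simp: dist_type2_interval_def type2_eq_iff max_def split: if_splits)
  show "dist x y \<le> dist x z + dist y z"
  proof -
    have bound: "\<bar>lowL u - lowL v\<bar> \<le> dist u v \<and> \<bar>uppL u - uppL v\<bar> \<le> dist u v \<and>
        \<bar>lowU u - lowU v\<bar> \<le> dist u v \<and> \<bar>uppU u - uppU v\<bar> \<le> dist u v" for u v :: type2_interval
      by (simp add: dist_type2_interval_def del: Max_insert)
    have "\<bar>lowL x - lowL y\<bar> \<le> dist x z + dist y z" "\<bar>uppL x - uppL y\<bar> \<le> dist x z + dist y z"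
      "\<bar>lowU x - lowU y\<bar> \<le> dist x z + dist y z" "\<bar>uppU x - uppU y\<bar> \<le> dist x z + dist y z"
      using bound[of x z] bound[of y z] by linarith+
    then show ?thesis
      by (subst dist_type2_interval_def) simp
  qed
qed (simp_all only: uniformity_type2_interval_def open_type2_interval_def)

end

lemma scaleR_zero_type2 [simp]: "r *\<^sub>R (0 :: type2_interval) = 0"
  by (simp add: type2_eq_iff entries_scaleR)

text \<open>
  For \<open>C = 0\<close> the limit of \<open>C f(x)\<close> always exists and carries no information about \<open>f\<close>:
  neither \<open>f\<close> nor \<open>\<bar>f\<bar>\<close> need have a limit. The theorem on the limit of \<open>C f(x)\<close>
  therefore needs the hypothesis \<open>C \<noteq> 0\<close>.
\<close>

lemma limit_scaleR_zero_counterexample: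
  fixes C :: type2_interval
  assumes "C = 0"
  shows "\<exists>(D :: real set) f F x\<^sub>0 L. x\<^sub>0 islimpt D \<and> (\<forall>x\<in>D. F x = f x *\<^sub>R C) \<and>
    (F \<longlongrightarrow> L) (at x\<^sub>0 within D) \<and>
    (\<nexists>l. (f \<longlongrightarrow> l) (at x\<^sub>0 within D)) \<and>
    (\<nexists>l. ((\<lambda>x. \<bar>f x\<bar>) \<longlongrightarrow> l) (at x\<^sub>0 within D))"
proof -
  define f :: "real \<Rightarrow> real" where "f x = (if 0 < x then 1 else 0)" for x
  have no: "\<not> (f \<longlongrightarrow> l) (at 0)" for l
  proof
    assume l: "(f \<longlongrightarrow> l) (at 0)"
    have "(f \<longlongrightarrow> 1) (at_right 0)"
      by (rule tendsto_eventually) (auto simp: f_def eventually_at_filter)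
    moreover have "(f \<longlongrightarrow> 0) (at_left 0)"
      by (rule tendsto_eventually) (auto simp: f_def eventually_at_filter)
    moreover have "(f \<longlongrightarrow> l) (at_right 0)" "(f \<longlongrightarrow> l) (at_left 0)"
      using l by (simp_all add: filterlim_at_split)
    ultimately have "l = 1" "l = 0"
      by (auto intro: tendsto_unique[rotated] simp: trivial_limit_at_left_real)
    then show False by simp
  qed
  have abs: "(\<lambda>x. \<bar>f x\<bar>) = f"
    by (auto simp: f_def)
  have "(0 :: real) islimpt UNIV \<and> (\<forall>x\<in>UNIV. (0 :: type2_interval) = f x *\<^sub>R C) \<and>
      ((\<lambda>x. 0 :: type2_interval) \<longlongrightarrow> 0) (at (0 :: real) within UNIV) \<and>
      (\<nexists>l. (f \<longlongrightarrow> l) (at 0 within UNIV)) \<and>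
      (\<nexists>l. ((\<lambda>x. \<bar>f x\<bar>) \<longlongrightarrow> l) (at 0 within UNIV))"
    using no assms by (simp add: abs islimpt_UNIV)
  then show ?thesis by (intro exI)
qed

end

theory Submission
  imports Defs
begin

text \<open>
  The sums of the two outer and of the two inner entries of \<open>r *\<^sub>R C\<close> are \<open>r * (lowL C + uppU C)\<close>
  and \<open>r * (uppL C + lowU C)\<close>, whatever the sign of \<open>r\<close>. If one of these factors is nonzero, dividing
  by it recovers the limit of \<open>f\<close> from that of \<open>F\<^sub>2\<close>, and case (a) follows because \<open>r *\<^sub>R C\<close> is
  continuous in \<open>r\<close>. If both vanish, \<open>C\<close> is symmetric, and its upper entry \<open>\<bar>f x\<bar> * uppU C\<close>
  recovers the limit of \<open>\<bar>f\<bar>\<close>.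
\<close>

lemma dist_type2_interval_eq_max:
  "dist X Y = max \<bar>lowL X - lowL Y\<bar> (max \<bar>uppL X - uppL Y\<bar>
    (max \<bar>lowU X - lowU Y\<bar> \<bar>uppU X - uppU Y\<bar>))"
  by (simp add: dist_type2_interval_def)

text \<open>A maximum is below \<epsilon> iff each of its arguments is, so convergence is
  entrywise.\<close>

lemma tendsto_type2_interval_iff:
  "(F \<longlongrightarrow> L) G \<longleftrightarrow>
    ((\<lambda>x. lowL (F x)) \<longlongrightarrow> lowL L) G \<and> ((\<lambda>x. uppL (F x)) \<longlongrightarrow> uppL L) G \<and>
    ((\<lambda>x. lowU (F x)) \<longlongrightarrow> lowU L) G \<and> ((\<lambda>x. uppU (F x)) \<longlongrightarrow> uppU L) G"
  unfolding tendsto_iff dist_type2_interval_eq_max dist_real_def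
  by (auto simp: eventually_conj_iff)

text \<open>The sign test in \<open>entries_scaleR\<close> hides the continuity in \<open>r\<close>;
  \<open>min\<close> and \<open>max\<close> of linear terms expose it to
  \<open>tendsto_intros\<close>.\<close>

lemma entries_scaleR_min_max:
  "lowL (r *\<^sub>R A) = min (r * lowL A) (r * uppU A)"
  "uppL (r *\<^sub>R A) = min (r * uppL A) (r * lowU A)"
  "lowU (r *\<^sub>R A) = max (r * uppL A) (r * lowU A)"
  "uppU (r *\<^sub>R A) = max (r * lowL A) (r * uppU A)"
proof -
  have "lowL A \<le> uppU A"
    using entries_le[of A] by linarith
  then show
    "lowL (r *\<^sub>R A) = min (r * lowL A) (r * uppU A)"
    "uppL (r *\<^sub>R A) = min (r * uppL A) (r * lowU A)"
    "lowU (r *\<^sub>R A) = max (r * uppL A) (r * lowU A)"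
    "uppU (r *\<^sub>R A) = max (r * lowL A) (r * uppU A)"
    by (auto simp: entries_scaleR min_def max_def mult_le_cancel_left
        intro: antisym)
qed

lemma tendsto_scaleR_type2_interval:
  assumes "(f \<longlongrightarrow> l) G"
  shows "((\<lambda>x. f x *\<^sub>R (C :: type2_interval)) \<longlongrightarrow> l *\<^sub>R C) G"
  unfolding tendsto_type2_interval_iff entries_scaleR_min_max
  by (intro conjI tendsto_intros assms)

lemma tendsto_mult_right_cancel:
  fixes f :: "'a \<Rightarrow> real"
  assumes "((\<lambda>x. f x * c) \<longlongrightarrow> l) G" "c \<noteq> 0"
  shows "(f \<longlongrightarrow> l / c) G"
  using tendsto_divide[OF assms(1) tendsto_const assms(2)] assms(2) by simp

text \<open>A negative factor swaps entries only within the outer and within the inner pair, so the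
  sums need no sign test.\<close>

lemma outer_inner_sums_scaleR:
  "lowL (r *\<^sub>R A) + uppU (r *\<^sub>R A) = r * (lowL A + uppU A)"
  "uppL (r *\<^sub>R A) + lowU (r *\<^sub>R A) = r * (uppL A + lowU A)"
  by (simp_all add: entries_scaleR algebra_simps)

text \<open>Negating an interval swaps its endpoints, which pairs \<open>lowL\<close> with
  \<open>uppU\<close> and \<open>uppL\<close> with \<open>lowU\<close>.\<close>

lemma intervalL_eq_uminus_intervalU_iff:
  "intervalL A = - intervalU A \<longleftrightarrow> lowL A + uppU A = 0 \<and> uppL A + lowU A = 0"
  by (auto simp: interval_eq_iff)

theorem theorem6p3:
  fixes D :: "real set" and f :: "real \<Rightarrow> real" and C :: type2_interval
    and F\<^sub>2 :: "real \<Rightarrow> type2_interval" and x\<^sub>0 :: real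
  assumes "C \<noteq> 0"
    and "\<And>x. x \<in> D \<Longrightarrow> F\<^sub>2 x = f x *\<^sub>R C"
    and "x\<^sub>0 islimpt D"
    and "\<exists>L. (F\<^sub>2 \<longlongrightarrow> L) (at x\<^sub>0 within D)"
  shows "(\<exists>l. (f \<longlongrightarrow> l) (at x\<^sub>0 within D) \<and> (F\<^sub>2 \<longlongrightarrow> l *\<^sub>R C) (at x\<^sub>0 within D)) \<or>
    (\<exists>m. ((\<lambda>x. \<bar>f x\<bar>) \<longlongrightarrow> m) (at x\<^sub>0 within D)) \<and> intervalL C = - intervalU C"
proof -
  let ?G = "at x\<^sub>0 within D"
  have F_cong: "(F\<^sub>2 \<longlongrightarrow> L) ?G \<longleftrightarrow> ((\<lambda>x. f x *\<^sub>R C) \<longlongrightarrow> L) ?G" for L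
    by (rule Lim_cong_within) (simp_all add: assms(2))
  obtain L where L: "((\<lambda>x. f x *\<^sub>R C) \<longlongrightarrow> L) ?G"
    using assms(4) F_cong by blast
  note entries_lim = L[unfolded tendsto_type2_interval_iff]
  show ?thesis
  proof (cases "intervalL C = - intervalU C")
    case True
    then have sym: "lowL C = - uppU C" "uppL C = - lowU C"
      by (simp_all add: intervalL_eq_uminus_intervalU_iff add_eq_0_iff2)
    \<comment> \<open>Otherwise symmetry gives \<open>lowL C = 0\<close> too, and the ordering
      squeezes the inner entries to 0, against \<open>C \<noteq> 0\<close>.\<close>
    have "uppU C \<noteq> 0"
    proof
      assume "uppU C = 0"
      with sym entries_le[of C] have "lowU C = 0"
        by linarith
      with \<open>uppU C = 0\<close> sym \<open>C \<noteq> 0\<close> show False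
        by (simp add: type2_eq_iff)
    qed
    \<comment> \<open>For \<open>f x < 0\<close> this entry is \<open>f x * lowL C\<close>, and
      \<open>lowL C = - uppU C\<close> flips the sign.\<close>
    moreover have "uppU (f x *\<^sub>R C) = \<bar>f x\<bar> * uppU C" for x
      using sym by (simp add: entries_scaleR)
    ultimately have "((\<lambda>x. \<bar>f x\<bar>) \<longlongrightarrow> uppU L / uppU C) ?G"
      using entries_lim by (auto intro: tendsto_mult_right_cancel)
    then show ?thesis
      using True by blast
  next
    case False
    have "((\<lambda>x. f x * (lowL C + uppU C)) \<longlongrightarrow> lowL L + uppU L) ?G"
      "((\<lambda>x. f x * (uppL C + lowU C)) \<longlongrightarrow> uppL L + lowU L) ?G"
      unfolding outer_inner_sums_scaleR[symmetric] using entries_lim by (auto intro: tendsto_add)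
    with False obtain l where "(f \<longlongrightarrow> l) ?G"
      unfolding intervalL_eq_uminus_intervalU_iff by (blast intro: tendsto_mult_right_cancel)
    then show ?thesis
      using F_cong tendsto_scaleR_type2_interval by blast
  qed
qed

end
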